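(* Let $M\ge N\ge 1$ be integers and let $b=(b_0,\dots,b_{M-1})\in\mathbb{R}^M$. Then there exists a vector $x_\star\in\mathbb{C}^N$ whose least-squares cost attains the optimal value of the semidefinite relaxation, i.e. $$\sum_{m=0}^{M-1}\left(b_m-|f_m^H x_\star|^2\right)^2=\min_{X\in\mathbb{H}_+^{N}}\ \sum_{m=0}^{M-1}\left(b_m-\mathrm{tr}\left(f_m f_m^H X\right)\right)^2 .$$ Consequently $$\min_{x\in\mathbb{C}^N}\big\|\,b-|F_M x|^2\,\big\|^2=\min_{X\in\mathbb{H}_+^{N}}\ \sum_{m=0}^{M-1}\left(b_m-\mathrm{tr}\left(f_m f_m^H X\right)\right)^2 .$$
   Context: Indices of vectors and matrices start at $0$. $F_M\in\mathbb{C}^{M\times N}$ consists of the first $N$ columns of the $M$-point DFT matrix: its $(m,n)$ entry is $\phi^{mn}$ with $\phi=e^{-j2\pi/M}$, $j^2=-1$, $0\le m\le M-1$, $0\le n\le N-1$. The row vector $f_m^H$ is the $m$th row of $F_M$, and $f_m\in\mathbb{C}^N$ is its Hermitian transpose. $|\cdot|^2$ applied to a vector is taken element-wise, so $|F_Mx|^2$ has entries $|f_m^Hx|^2$; $\|\cdot\|$ is the Euclidean norm. $\mathbb{H}_+^N$ is the set of $N\times N$ complex Hermitian positive semidefinite matrices. *)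

theory Defs
  imports
    "Jordan_Normal_Form.Schur_Decomposition"
    "HOL-Analysis.L2_Norm"
begin

definition dft_mat :: "nat \<Rightarrow> nat \<Rightarrow> complex mat" where
  "dft_mat M N = mat M N (\<lambda>(m, n). exp (- (\<i> * of_real (2 * pi / real M))) ^ (m * n))"

text \<open>The row vector \<open>f\<^sub>m\<^sup>H\<close> is row \<open>m\<close> of the DFT matrix, so the column vector \<open>f\<^sub>m\<close>
  is its entrywise conjugate.\<close>

definition dft_vec :: "nat \<Rightarrow> nat \<Rightarrow> nat \<Rightarrow> complex vec" where
  "dft_vec M N m = conjugate (row (dft_mat M N) m)"

definition sq_abs_vec :: "complex vec \<Rightarrow> real vec" where
  "sq_abs_vec v = map_vec (\<lambda>z. (cmod z)\<^sup>2) v"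

definition eucl_norm :: "real vec \<Rightarrow> real" where
  "eucl_norm v = L2_set (\<lambda>i. v $ i) {..<dim_vec v}"

definition trace :: "complex mat \<Rightarrow> complex" where
  "trace A = (\<Sum>i<dim_row A. A $$ (i, i))"

text \<open>The rank-one matrix \<open>v v\<^sup>H\<close>.\<close>

definition outer_self :: "complex vec \<Rightarrow> complex mat" where
  "outer_self v = mat (dim_vec v) (dim_vec v) (\<lambda>(i, j). v $ i * cnj (v $ j))"

text \<open>As \<open>u \<bullet>c v\<close> conjugates its second argument, \<open>(X *\<^sub>v v) \<bullet>c v\<close> is \<open>v\<^sup>H X v\<close>, which is real
  for Hermitian \<open>X\<close>.\<close>

definition hermitian_psd :: "nat \<Rightarrow> complex mat set" where
  "hermitian_psd N = {X \<in> carrier_mat N N. mat_adjoint X = X \<and>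
     (\<forall>v \<in> carrier_vec N. 0 \<le> Re ((X *\<^sub>v v) \<bullet>c v))}"

text \<open>The summands are \<open>(b\<^sub>m - \<bar>f\<^sub>m\<^sup>H x\<bar>\<^sup>2)\<^sup>2\<close>, with \<open>x \<bullet>c f\<^sub>m = f\<^sub>m\<^sup>H x\<close>.\<close>

definition ls_cost :: "nat \<Rightarrow> nat \<Rightarrow> real vec \<Rightarrow> complex vec \<Rightarrow> real" where
  "ls_cost M N b x = (\<Sum>m<M. (b $ m - (cmod (x \<bullet>c dft_vec M N m))\<^sup>2)\<^sup>2)"

text \<open>For Hermitian \<open>X\<close> the trace below is real (\<open>trace_outer_self_real\<close>), so that taking
  the real part only changes the type.\<close>

definition sdp_cost :: "nat \<Rightarrow> nat \<Rightarrow> real vec \<Rightarrow> complex mat \<Rightarrow> real" where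
  "sdp_cost M N b X = (\<Sum>m<M. (b $ m - Re (trace (outer_self (dft_vec M N m) * X)))\<^sup>2)"

lemma hermitian_index:
  assumes "X \<in> carrier_mat N N" "mat_adjoint X = X" "i < N" "j < N"
  shows "cnj (X $$ (i, j)) = X $$ (j, i)"
proof -
  have "mat_adjoint X $$ (j, i) = cnj (X $$ (i, j))"
    using assms(1,3,4) by (simp add: mat_adjoint_def mat_of_rows_index)
  then show ?thesis
    using assms(2) by simp
qed

lemma trace_outer_self_real:
  assumes X: "X \<in> hermitian_psd N" and v: "v \<in> carrier_vec N"
  shows "trace (outer_self v * X) \<in> \<real>"
proof -
  have XN: "X \<in> carrier_mat N N" and XH: "mat_adjoint X = X"
    using X by (auto simp: hermitian_psd_def)
  have tr: "trace (outer_self v * X) = (\<Sum>i<N. \<Sum>j<N. v $ i * cnj (v $ j) * X $$ (j, i))"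
    using XN v by (auto simp: trace_def outer_self_def scalar_prod_def atLeast0LessThan intro!: sum.cong)
  have "cnj (trace (outer_self v * X)) = (\<Sum>i<N. \<Sum>j<N. cnj (v $ i) * v $ j * X $$ (i, j))"
    unfolding tr by (auto simp: hermitian_index[OF XN XH] intro!: sum.cong)
  also have "\<dots> = trace (outer_self v * X)"
    unfolding tr by (subst sum.swap) (simp add: mult.commute)
  finally show ?thesis
    by (simp add: Reals_cnj_iff)
qed

end

theory Submission
  imports "HOL-Analysis.Complex_Analysis_Basics" Defs
begin

text \<open>
  For positive semidefinite \<open>X\<close> and \<open>f\<^sub>w = (1, cnj w, cnj w\<^sup>2, \<dots>)\<close> with \<open>\<bar>w\<bar> = 1\<close>, the quantity
  \<open>tr (f\<^sub>w f\<^sub>w\<^sup>H X) = f\<^sub>w\<^sup>H X f\<^sub>w\<close> is a trigonometric polynomial in \<open>w\<close> of degree at most \<open>N - 1\<close> that is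
  nonnegative on the whole unit circle, and the DFT vectors are the \<open>f\<^sub>w\<close> for \<open>M\<close> particular
  points \<open>w\<close>.  By the Fejer-Riesz theorem (\<open>fejer_riesz\<close>) it equals \<open>\<bar>p(w)\<bar>\<^sup>2\<close> for a polynomial \<open>p\<close> of
  degree at most \<open>N - 1\<close>.  The coefficient vector \<open>x\<close> of \<open>p\<close> then has \<open>\<bar>f\<^sub>w\<^sup>H x\<bar>\<^sup>2 = tr (f\<^sub>w f\<^sub>w\<^sup>H X)\<close> for all
  \<open>w\<close> on the circle (\<open>psd_agrees_with_vector_on_circle\<close>), in particular at the DFT nodes, so every value
  of the relaxed cost is already a value of the least-squares cost.  Conversely a vector \<open>x\<close> gives
  the feasible matrix \<open>x x\<^sup>H\<close> of the same cost.  The two problems thus have the same set of values.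

  It remains to see that the minimum is attained.  Since \<open>N \<le> M\<close>, inverting the DFT bounds the
  entries of \<open>x\<close> by the values \<open>f\<^sub>m\<^sup>H x\<close>, hence by the cost (\<open>sublevel_entry_bound\<close>); sublevel sets of the
  least-squares cost are bounded and compactness applies (\<open>ls_cost_min_exists\<close>).

  The Fejer-Riesz theorem is proved by induction on the degree.  A trigonometric polynomial
  \<open>Q(w) / w\<^sup>n\<close> that is real on the circle has a self-reciprocal \<open>Q\<close>, so the roots of \<open>Q\<close> come in pairs
  \<open>a\<close>, \<open>1 / cnj a\<close>; nonnegativity makes roots on the circle double.  Each pair contributes a factor
  \<open>(w - a) (1 - cnj a w) / w = \<bar>w - a\<bar>\<^sup>2\<close>, which is split off.
\<close>

section \<open>Polynomials on the unit circle\<close>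

lemma infinite_unit_circle: "infinite {w::complex. cmod w = 1}"
proof
  assume fin: "finite {w::complex. cmod w = 1}"
  define n where "n = Suc (card {w::complex. cmod w = 1})"
  have "{w::complex. w ^ n = 1} \<subseteq> {w. cmod w = 1}"
    using power_eq_1_iff[of _ n] by (auto simp: n_def dest: power_eq_1_iff)
  then have "card {w::complex. w ^ n = 1} \<le> card {w::complex. cmod w = 1}"
    by (rule card_mono[OF fin])
  moreover have "card {w::complex. w ^ n = 1} = n"
    by (rule card_roots_unity_eq) (simp add: n_def)
  ultimately show False
    by (simp add: n_def)
qed

lemma inverse_cnj_unit_circle:
  assumes "cmod w = 1"
  shows "w \<noteq> 0" and "cnj w = 1 / w"
  using assms complex_norm_square[of w] by (auto simp: eq_divide_eq mult.commute)

lemma poly_eq_sum_atMost: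
  fixes p :: "'a::comm_semiring_1 poly"
  assumes "degree p \<le> n"
  shows "poly p z = (\<Sum>k\<le>n. coeff p k * z ^ k)"
  unfolding poly_altdef
  by (rule sum.mono_neutral_left) (use assms in \<open>auto simp: coeff_eq_0\<close>)

text \<open>\<open>Q\<close> and its reversed conjugate \<open>z\<^bsup>2n\<^esup> cnj (Q (1 / cnj z))\<close> are polynomials that agree on the unit
  circle, where \<open>1 / cnj w = w\<close>; the circle is infinite, so they are equal.  The first conclusion is
  this equality for coefficients (pairing the root \<open>0\<close> with a drop in degree), the second for values
  (pairing a root \<open>a \<noteq> 0\<close> with \<open>1 / cnj a\<close>).\<close>

lemma self_reciprocal:
  fixes Q :: "complex poly"
  assumes deg: "degree Q \<le> 2 * n"
    and real: "\<And>w. cmod w = 1 \<Longrightarrow> poly Q w / w ^ n \<in> \<real>"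
  shows "k \<le> 2 * n \<Longrightarrow> coeff Q k = cnj (coeff Q (2 * n - k))"
    and "z \<noteq> 0 \<Longrightarrow> poly Q z = z ^ (2 * n) * cnj (poly Q (1 / cnj z))"
proof -
  define S where "S = (\<Sum>k\<le>2*n. monom (cnj (coeff Q (2*n - k))) k)"
  have coeff_S: "coeff S k = (if k \<le> 2*n then cnj (coeff Q (2*n - k)) else 0)" for k
    by (auto simp: S_def coeff_sum if_distrib[of "\<lambda>x. x = _"] sum.delta)
  have poly_S: "poly S z = z ^ (2*n) * cnj (poly Q (1 / cnj z))" if "z \<noteq> 0" for z
  proof -
    have "poly S z = (\<Sum>k\<le>2*n. cnj (coeff Q (2*n - k)) * z ^ k)"
      by (simp add: S_def poly_sum poly_monom)
    also have "\<dots> = (\<Sum>k\<le>2*n. cnj (coeff Q k) * z ^ (2*n - k))"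
      by (rule sum.reindex_bij_witness[of _ "\<lambda>k. 2*n - k" "\<lambda>k. 2*n - k"]) auto
    also have "\<dots> = (\<Sum>k\<le>2*n. z ^ (2*n) * (cnj (coeff Q k) * (1 / z) ^ k))"
      using that by (intro sum.cong) (auto simp: power_diff power_divide)
    also have "\<dots> = z ^ (2*n) * cnj (poly Q (1 / cnj z))"
      by (simp add: poly_eq_sum_atMost[OF deg] sum_distrib_left)
    finally show ?thesis .
  qed
  have on_circle: "poly (S - Q) w = 0" if w: "cmod w = 1" for w
  proof -
    note w0 = inverse_cnj_unit_circle[OF w]
    have "cnj (poly Q w / w ^ n) = poly Q w / w ^ n"
      using real[OF w] by (simp add: Reals_cnj_iff)
    then have "cnj (poly Q w) * w ^ n = poly Q w / w ^ n"
      using w0 by (simp add: power_divide)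
    then have "cnj (poly Q w) * w ^ (2 * n) = poly Q w"
      using w0(1) by (simp add: field_simps power_mult power2_eq_square mult_2 power_add)
    then show ?thesis
      using poly_S[OF w0(1)] w0 by (simp add: mult.commute)
  qed
  have "S - Q = 0"
  proof (rule ccontr)
    assume "S - Q \<noteq> 0"
    then have "finite {w. poly (S - Q) w = 0}"
      by (rule poly_roots_finite)
    then have "finite {w::complex. cmod w = 1}"
      by (rule rev_finite_subset) (use on_circle in auto)
    then show False
      using infinite_unit_circle by blast
  qed
  then have "S = Q" by simp
  then show "k \<le> 2 * n \<Longrightarrow> coeff Q k = cnj (coeff Q (2 * n - k))"
    and "z \<noteq> 0 \<Longrightarrow> poly Q z = z ^ (2 * n) * cnj (poly Q (1 / cnj z))"
    using coeff_S[of k] poly_S[of z] by auto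
qed

text \<open>At a zero on the circle the real-valued function \<open>t \<mapsto> Q(e\<^bsup>it\<^esup>) e\<^bsup>-int\<^esup>\<close> has a minimum, so its derivative
  vanishes there.\<close>

lemma circle_root_of_nonneg_is_double:
  fixes Q :: "complex poly"
  assumes nonneg: "\<And>w. cmod w = 1 \<Longrightarrow> poly Q w / w ^ n \<in> \<real>\<^sub>\<ge>\<^sub>0"
    and a: "cmod a = 1" "poly Q a = 0"
  shows "poly (pderiv Q) a = 0"
proof -
  define f where "f t = poly Q (exp (\<i> * t)) * exp (- (of_nat n * \<i> * t))" for t :: complex
  obtain s where s: "a = cis s"
    using a(1) rcis_cmod_Arg[of a] by (metis mult_1 of_real_1 rcis_def)
  have as: "a = exp (\<i> * of_real s)"
    by (simp add: s cis_conv_exp)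
  have f_circle: "f (of_real t) \<in> \<real>\<^sub>\<ge>\<^sub>0" for t :: real
  proof -
    have "f (of_real t) = poly Q (cis t) / cis t ^ n"
      by (simp add: f_def cis_conv_exp exp_minus exp_of_nat_mult[symmetric] divide_inverse mult.assoc)
    then show ?thesis
      using nonneg[of "cis t"] by simp
  qed
  define D where "D = poly (pderiv Q) a * \<i> * a * exp (- (of_nat n * \<i> * of_real s))"
  have "(f has_field_derivative D) (at (of_real s))"
    unfolding f_def[abs_def] D_def
    by (rule derivative_eq_intros DERIV_chain2[OF poly_DERIV] refl)+ (use a(2) in \<open>simp add: as\<close>)
  then have "((\<lambda>t. f (of_real t)) has_vector_derivative D) (at s)"
    by (rule has_vector_derivative_real_field)
  then have dRe: "((\<lambda>t. Re (f (of_real t))) has_real_derivative Re D) (at s)"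
    and dIm: "((\<lambda>t. Im (f (of_real t))) has_real_derivative Im D) (at s)"
    by (simp_all add: has_vector_derivative_complex_iff)
  have "Re D = 0"
  proof (rule DERIV_local_min[OF dRe, of 1])
    show "\<forall>y. \<bar>s - y\<bar> < 1 \<longrightarrow> Re (f (of_real s)) \<le> Re (f (of_real y))"
      using f_circle a(2) by (auto simp: complex_nonneg_Reals_iff f_def as)
  qed simp
  moreover have "Im D = 0"
  proof -
    have "(\<lambda>t. Im (f (of_real t))) = (\<lambda>_. 0)"
      using f_circle by (auto simp: complex_nonneg_Reals_iff)
    then show ?thesis
      using dIm DERIV_unique[OF _ DERIV_const] by metis
  qed
  ultimately have "D = 0"
    by (simp add: complex_eq_iff)
  then show ?thesis
    using as by (simp add: D_def)
qed

text \<open>A root \<open>a \<noteq> 0\<close> is paired with \<open>1 / cnj a\<close>, which is a second root if \<open>\<bar>a\<bar> \<noteq> 1\<close> and the same root with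
  multiplicity two if \<open>\<bar>a\<bar> = 1\<close>.  If \<open>0\<close> is a root, then \<open>a = 0\<close> serves: the factor is just \<open>z\<close>, and
  the vanishing top coefficient provides the second drop in the degree bound.\<close>

lemma exists_circle_factor:
  fixes Q :: "complex poly"
  assumes deg: "degree Q \<le> 2 * Suc n"
    and nonneg: "\<And>w. cmod w = 1 \<Longrightarrow> poly Q w / w ^ Suc n \<in> \<real>\<^sub>\<ge>\<^sub>0"
  obtains a R where "Q = [:-a, 1:] * [:1, -cnj a:] * R" and "degree R \<le> 2 * n"
proof (cases "coeff Q 0 = 0")
  case True
  have real: "\<And>w. cmod w = 1 \<Longrightarrow> poly Q w / w ^ Suc n \<in> \<real>"
    using nonneg by blast
  have "coeff Q (2 * Suc n) = 0"
    using self_reciprocal(1)[OF deg real, of "2 * Suc n"] True by simp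
  then have "degree Q \<noteq> 2 * Suc n"
    by (metis leading_coeff_0_iff degree_0 mult_is_0 nat.distinct(1) zero_neq_numeral)
  obtain R where R: "Q = pCons 0 R"
    using True by (metis coeff_pCons_0 pCons_cases)
  have "degree R \<le> 2 * n"
    using \<open>degree Q \<noteq> _\<close> deg by (auto simp: R split: if_splits)
  then show ?thesis
    using that[of 0 R] R by (simp add: mult_pCons_left)
next
  case False
  have real: "\<And>w. cmod w = 1 \<Longrightarrow> poly Q w / w ^ Suc n \<in> \<real>"
    using nonneg by blast
  have "coeff Q (2 * Suc n) \<noteq> 0"
    using self_reciprocal(1)[OF deg real, of "2 * Suc n"] False by simp
  then have degQ: "degree Q = 2 * Suc n"
    using deg le_degree by (metis le_antisym)
  then have "\<not> constant (poly Q)"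
    by (simp add: constant_degree)
  then obtain a where a: "poly Q a = 0"
    using fundamental_theorem_of_algebra by blast
  have a0: "a \<noteq> 0"
    using a False by (auto simp: poly_0_coeff_0)
  obtain Q1 where Q1: "Q = [:-a, 1:] * Q1"
    using a by (auto simp: poly_eq_0_iff_dvd elim: dvdE)
  have "poly Q1 (1 / cnj a) = 0"
  proof (cases "cmod a = 1")
    case True
    have "poly (pderiv Q) a = 0"
      by (rule circle_root_of_nonneg_is_double[OF nonneg True a])
    then have "poly Q1 a = 0"
      unfolding Q1 pderiv_mult poly_add poly_mult by (simp add: pderiv_pCons)
    then show ?thesis
      using inverse_cnj_unit_circle[OF True] by simp
  next
    case False
    have "poly Q (1 / cnj a) = 0"
      using self_reciprocal(2)[OF deg real, of "1 / cnj a"] a a0 by simp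
    moreover have "1 / cnj a \<noteq> a"
    proof
      assume "1 / cnj a = a"
      then have "a * cnj a = 1"
        using a0 by (simp add: field_simps)
      then have "(cmod a)\<^sup>2 = 1"
        by (metis complex_norm_square of_real_eq_1_iff)
      then show False
        using False norm_ge_zero[of a] by (auto simp: power2_eq_1_iff simp del: norm_ge_zero)
    qed
    ultimately show ?thesis
      by (simp add: Q1 poly_mult del: mult_pCons_left)
  qed
  then obtain Q2 where Q2: "Q1 = [:-(1 / cnj a), 1:] * Q2"
    by (auto simp: poly_eq_0_iff_dvd elim: dvdE)
  \<comment> \<open>\<open>z - 1 / cnj a = (- 1 / cnj a) (1 - cnj a z)\<close>, and the constant is moved into the quotient.\<close>
  define R where "R = smult (- 1 / cnj a) Q2"
  have QR: "Q = [:-a, 1:] * [:1, -cnj a:] * R"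
    unfolding Q1 Q2 R_def using a0 by (simp add: smult_add_right smult_diff_right smult_add_left algebra_simps)
  have "R \<noteq> 0"
    using QR degQ by auto
  then have "degree Q = 2 + degree R"
    unfolding QR using a0 by (simp add: degree_mult_eq del: mult_pCons_left mult_pCons_right)
  then show ?thesis
    using that[OF QR] degQ by simp
qed

lemma circle_factor_eq_norm:
  assumes "cmod w = 1"
  shows "poly ([:-a, 1:] * [:1, -cnj a:]) w / w = of_real ((cmod (w - a))\<^sup>2)"
proof -
  note w = inverse_cnj_unit_circle[OF assms]
  have "of_real ((cmod (w - a))\<^sup>2) = (w - a) * (1 / w - cnj a)"
    using complex_norm_square[of "w - a"] by (simp add: w)
  then show ?thesis
    using w(1) by (simp add: field_simps)
qed

text \<open>Dividing \<open>Q(w) / w\<^bsup>n+1\<^esup>\<close> by \<open>\<bar>w - a\<bar>\<^sup>2\<close> says nothing at \<open>w = a\<close> itself when \<open>\<bar>a\<bar> = 1\<close>; this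
  lemma fills that gap in the induction.\<close>

lemma nonneg_on_circle_by_continuity:
  fixes R :: "complex poly"
  assumes off: "\<And>w. cmod w = 1 \<Longrightarrow> w \<noteq> a \<Longrightarrow> poly R w / w ^ n \<in> \<real>\<^sub>\<ge>\<^sub>0"
    and w: "cmod w = 1"
  shows "poly R w / w ^ n \<in> \<real>\<^sub>\<ge>\<^sub>0"
proof (cases "w = a")
  case True
  \<comment> \<open>Approach the exceptional point along the circle, without meeting it.\<close>
  define u where "u k = w * cis (1 / real (Suc k))" for k
  have u_circle: "cmod (u k) = 1" for k
    using w by (simp add: u_def norm_mult)
  have u_ne: "u k \<noteq> a" for k
  proof
    assume "u k = a"
    then have "cis (1 / real (Suc k)) = 1"
      using True w by (auto simp: u_def)
    then have "sin (1 / real (Suc k)) = 0"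
      by (metis cis.sel(2) one_complex.sel(2))
    moreover have "sin (1 / real (Suc k)) > 0"
    proof (rule sin_gt_zero)
      have "1 / real (Suc k) \<le> 1" by simp
      then show "1 / real (Suc k) < pi" using pi_ge_two by linarith
    qed simp
    ultimately show False by simp
  qed
  have "(\<lambda>k. 1 / real (Suc k)) \<longlonglongrightarrow> 0"
    using LIMSEQ_inverse_real_of_nat by (simp add: inverse_eq_divide)
  then have "(\<lambda>k. w * exp (\<i> * of_real (1 / real (Suc k)))) \<longlonglongrightarrow> w * exp (\<i> * of_real 0)"
    by (intro tendsto_intros)
  then have "u \<longlonglongrightarrow> w"
    by (simp add: u_def[abs_def] cis_conv_exp)
  then have lim: "(\<lambda>k. poly R (u k) / u k ^ n) \<longlonglongrightarrow> poly R w / w ^ n"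
    using w by (intro tendsto_intros) auto
  have "poly R (u k) / u k ^ n \<in> \<real>\<^sub>\<ge>\<^sub>0" for k
    using off u_circle u_ne by blast
  then show ?thesis
    by (rule closed_sequentially[OF closed_nonneg_Reals_complex _ lim])
qed (use off w in blast)

section \<open>The Fejer-Riesz theorem\<close>

theorem fejer_riesz:
  fixes Q :: "complex poly"
  assumes "degree Q \<le> 2 * n"
    and "\<And>w. cmod w = 1 \<Longrightarrow> poly Q w / w ^ n \<in> \<real>\<^sub>\<ge>\<^sub>0"
  obtains p :: "complex poly" where "degree p \<le> n"
    and "\<And>w. cmod w = 1 \<Longrightarrow> poly Q w / w ^ n = of_real ((cmod (poly p w))\<^sup>2)"
proof -
  have "\<exists>p. degree p \<le> n \<and> (\<forall>w. cmod w = 1 \<longrightarrow> poly Q w / w ^ n = of_real ((cmod (poly p w))\<^sup>2))"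
    using assms
  proof (induction n arbitrary: Q)
    case 0
    then obtain c where c: "Q = [:c:]"
      by (auto elim: degree_eq_zeroE)
    have "c \<in> \<real>\<^sub>\<ge>\<^sub>0"
      using "0.prems"(2)[of 1] by (simp add: c)
    then obtain r where r: "c = of_real r" "r \<ge> 0"
      by (auto elim: nonneg_Reals_cases)
    then show ?case
      by (intro exI[of _ "[:of_real (sqrt r):]"]) (simp add: c)
  next
    case (Suc n)
    obtain a R where QR: "Q = [:-a, 1:] * [:1, -cnj a:] * R" and degR: "degree R \<le> 2 * n"
      using exists_circle_factor[OF Suc.prems] by blast
    have factored: "poly Q w / w ^ Suc n = of_real ((cmod (w - a))\<^sup>2) * (poly R w / w ^ n)"
      if "cmod w = 1" for w
      unfolding circle_factor_eq_norm[OF that, symmetric] QR poly_mult by simp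
    have R_off: "poly R w / w ^ n \<in> \<real>\<^sub>\<ge>\<^sub>0" if w: "cmod w = 1" "w \<noteq> a" for w
    proof -
      have "poly R w / w ^ n = (poly Q w / w ^ Suc n) / of_real ((cmod (w - a))\<^sup>2)"
        unfolding factored[OF w(1)] using w(2) by simp
      then show ?thesis
        using Suc.prems(2)[OF w(1)]
        by (metis nonneg_Reals_divide_I nonneg_Reals_of_real_iff zero_le_power2)
    qed
    obtain p where p: "degree p \<le> n"
        "\<And>w. cmod w = 1 \<Longrightarrow> poly R w / w ^ n = of_real ((cmod (poly p w))\<^sup>2)"
      using Suc.IH[OF degR nonneg_on_circle_by_continuity[where a = a, OF R_off]] by blast
    have "degree ([:-a, 1:] * p) \<le> Suc n"
      using degree_mult_le[of "[:-a, 1:]" p] p(1) by simp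
    moreover have "poly Q w / w ^ Suc n = of_real ((cmod (poly ([:-a, 1:] * p) w))\<^sup>2)"
      if "cmod w = 1" for w
    proof -
      have "poly ([:-a, 1:] * p) w = (w - a) * poly p w"
        by (simp add: algebra_simps)
      then show ?thesis
        unfolding factored[OF that] p(2)[OF that] by (simp add: norm_mult power_mult_distrib)
    qed
    ultimately show ?case by blast
  qed
  then show ?thesis using that by blast
qed

section \<open>Both costs as sums over points of the unit circle\<close>

definition dft_node :: "nat \<Rightarrow> nat \<Rightarrow> complex" where
  "dft_node M m = cis (- (2 * pi * real m / real M))"

text \<open>The conjugate makes \<open>x \<bullet>c circle_vec N w\<close> the value at \<open>w\<close> of the polynomial with coefficients \<open>x\<close>.\<close>

definition circle_vec :: "nat \<Rightarrow> complex \<Rightarrow> complex vec" where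
  "circle_vec N w = vec N (\<lambda>n. cnj w ^ n)"

lemma circle_vec_carrier [simp]: "circle_vec N w \<in> carrier_vec N"
  by (simp add: circle_vec_def)

lemma norm_dft_node [simp]: "cmod (dft_node M m) = 1"
  by (simp add: dft_node_def)

lemma dft_mat_index:
  assumes "m < M" "n < N"
  shows "dft_mat M N $$ (m, n) = dft_node M m ^ n"
proof -
  have "exp (- (\<i> * of_real (2 * pi / real M))) ^ m = dft_node M m"
    by (simp add: dft_node_def cis_conv_exp exp_of_nat_mult[symmetric] algebra_simps)
  then show ?thesis
    using assms by (simp add: dft_mat_def power_mult)
qed

lemma dft_vec_eq_circle_vec:
  assumes "m < M"
  shows "dft_vec M N m = circle_vec N (dft_node M m)"
proof (rule eq_vecI)
  show "dim_vec (dft_vec M N m) = dim_vec (circle_vec N (dft_node M m))"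
    by (simp add: dft_vec_def circle_vec_def dft_mat_def)
  fix i assume "i < dim_vec (circle_vec N (dft_node M m))"
  then show "dft_vec M N m $ i = circle_vec N (dft_node M m) $ i"
    using assms dft_mat_index[OF assms, of i N]
    by (simp add: dft_vec_def circle_vec_def dft_mat_def)
qed

lemma scalar_prod_circle_vec:
  assumes "x \<in> carrier_vec N"
  shows "x \<bullet>c circle_vec N w = (\<Sum>n<N. x $ n * w ^ n)"
  using assms by (simp add: scalar_prod_def circle_vec_def atLeast0LessThan)

lemma ls_cost_eq:
  assumes "x \<in> carrier_vec N"
  shows "ls_cost M N b x = (\<Sum>m<M. (b $ m - (cmod (\<Sum>n<N. x $ n * dft_node M m ^ n))\<^sup>2)\<^sup>2)"
  using assms by (simp add: ls_cost_def dft_vec_eq_circle_vec scalar_prod_circle_vec)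

lemma eucl_norm_residual_eq_ls_cost:
  assumes x: "x \<in> carrier_vec N" and b: "b \<in> carrier_vec M"
  shows "(eucl_norm (b - sq_abs_vec (dft_mat M N *\<^sub>v x)))\<^sup>2 = ls_cost M N b x"
proof -
  have "(dft_mat M N *\<^sub>v x) $ m = (\<Sum>n<N. x $ n * dft_node M m ^ n)" if "m < M" for m
  proof -
    have "(dft_mat M N *\<^sub>v x) $ m = (\<Sum>n<N. dft_mat M N $$ (m, n) * x $ n)"
      using that x by (simp add: dft_mat_def scalar_prod_def atLeast0LessThan)
    then show ?thesis
      using that by (simp add: dft_mat_index mult.commute)
  qed
  moreover have "dim_vec (dft_mat M N *\<^sub>v x) = M"
    by (simp add: dft_mat_def)
  ultimately show ?thesis
    using b unfolding ls_cost_eq[OF x]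
    by (simp add: eucl_norm_def L2_set_def sq_abs_vec_def sum_nonneg del: dim_mult_mat_vec)
qed

lemma trace_outer_self_mult:
  assumes "X \<in> carrier_mat N N" "v \<in> carrier_vec N"
  shows "trace (outer_self v * X) = (X *\<^sub>v v) \<bullet>c v"
proof -
  have "trace (outer_self v * X) = (\<Sum>i<N. \<Sum>j<N. v $ i * cnj (v $ j) * X $$ (j, i))"
    using assms
    by (auto simp: trace_def outer_self_def scalar_prod_def atLeast0LessThan intro!: sum.cong)
  also have "\<dots> = (\<Sum>j<N. (\<Sum>i<N. X $$ (j, i) * v $ i) * cnj (v $ j))"
    by (subst sum.swap) (simp add: sum_distrib_left sum_distrib_right mult.commute mult.left_commute)
  also have "\<dots> = (X *\<^sub>v v) \<bullet>c v"
    using assms by (auto simp: scalar_prod_def atLeast0LessThan intro!: sum.cong)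
  finally show ?thesis .
qed

lemma nonneg_trace_outer_self:
  assumes X: "X \<in> hermitian_psd N" and v: "v \<in> carrier_vec N"
  shows "trace (outer_self v * X) \<in> \<real>\<^sub>\<ge>\<^sub>0"
proof -
  have "X \<in> carrier_mat N N" "0 \<le> Re ((X *\<^sub>v v) \<bullet>c v)"
    using X v by (auto simp: hermitian_psd_def)
  then show ?thesis
    using trace_outer_self_real[OF X v] trace_outer_self_mult[OF _ v]
    by (simp add: complex_nonneg_Reals_iff complex_is_Real_iff)
qed

section \<open>Every relaxed cost is the cost of a vector, and conversely\<close>

text \<open>The trigonometric polynomial \<open>f\<^sub>w\<^sup>H X f\<^sub>w\<close>, multiplied by \<open>w\<^bsup>N-1\<^esup>\<close>, is a polynomial of degree at most
  \<open>2 (N - 1)\<close> whose coefficients are the sums of the diagonals of \<open>X\<close>, and Fejer-Riesz applies to it.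
  The vector depends on \<open>X\<close> only, not on \<open>w\<close>, so it serves every number of sample points.\<close>

lemma psd_agrees_with_vector_on_circle:
  assumes X: "X \<in> hermitian_psd N" and N: "N \<ge> 1"
  obtains x where "x \<in> carrier_vec N"
    and "\<And>w. cmod w = 1 \<Longrightarrow>
      trace (outer_self (circle_vec N w) * X) = of_real ((cmod (x \<bullet>c circle_vec N w))\<^sup>2)"
proof -
  define n where "n = N - 1"
  have Nn: "N = Suc n"
    using N by (simp add: n_def)
  have XN: "X \<in> carrier_mat N N"
    using X by (simp add: hermitian_psd_def)
  \<comment> \<open>Here \<open>i \<le> n\<close>, so the subtraction in the exponent does not truncate.\<close>
  define Q where "Q = (\<Sum>j<N. \<Sum>i<N. monom (X $$ (j, i)) (n + j - i))"
  have deg: "degree Q \<le> 2 * n"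
    unfolding Q_def
    by (intro degree_sum_le order.trans[OF degree_monom_le]) (auto simp: Nn)
  have Q_circle: "poly Q w / w ^ n = trace (outer_self (circle_vec N w) * X)" if w: "cmod w = 1" for w
  proof -
    note w0 = inverse_cnj_unit_circle[OF w]
    have "trace (outer_self (circle_vec N w) * X) =
        (\<Sum>j<N. (\<Sum>i<N. X $$ (j, i) * cnj w ^ i) * w ^ j)"
      using XN trace_outer_self_mult[OF XN circle_vec_carrier]
      by (simp add: scalar_prod_def circle_vec_def atLeast0LessThan)
    also have "\<dots> = (\<Sum>j<N. \<Sum>i<N. X $$ (j, i) * w ^ (n + j - i) / w ^ n)"
      unfolding sum_distrib_right
      by (intro sum.cong refl)
        (use w0(1) in \<open>auto simp: Nn w0(2) power_diff power_add power_divide field_simps\<close>)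
    also have "\<dots> = poly Q w / w ^ n"
      by (simp add: Q_def poly_sum poly_monom sum_divide_distrib)
    finally show ?thesis ..
  qed
  have nonneg: "poly Q w / w ^ n \<in> \<real>\<^sub>\<ge>\<^sub>0" if "cmod w = 1" for w
    unfolding Q_circle[OF that] by (rule nonneg_trace_outer_self[OF X circle_vec_carrier])
  obtain p where p: "degree p \<le> n"
      "\<And>w. cmod w = 1 \<Longrightarrow> poly Q w / w ^ n = of_real ((cmod (poly p w))\<^sup>2)"
    using fejer_riesz[OF deg nonneg] by blast
  have "vec N (coeff p) \<bullet>c circle_vec N w = poly p w" for w
  proof -
    have "poly p w = (\<Sum>k<N. coeff p k * w ^ k)"
      by (simp add: poly_eq_sum_atMost[OF p(1)] Nn lessThan_Suc_atMost)
    then show ?thesis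
      by (simp add: scalar_prod_circle_vec)
  qed
  then show ?thesis
    using that[of "vec N (coeff p)"] Q_circle p(2) by simp
qed

lemma sdp_cost_attained_by_vector:
  assumes X: "X \<in> hermitian_psd N" and N: "N \<ge> 1"
  obtains x where "x \<in> carrier_vec N" and "ls_cost M N b x = sdp_cost M N b X"
proof -
  obtain x where x: "x \<in> carrier_vec N"
    and eq: "\<And>w. cmod w = 1 \<Longrightarrow>
      trace (outer_self (circle_vec N w) * X) = of_real ((cmod (x \<bullet>c circle_vec N w))\<^sup>2)"
    using psd_agrees_with_vector_on_circle[OF X N] by blast
  have "ls_cost M N b x = sdp_cost M N b X"
    by (simp add: ls_cost_def sdp_cost_def dft_vec_eq_circle_vec eq)
  with x show ?thesis by (rule that)
qed

lemma outer_self_scalar_prod: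
  assumes "x \<in> carrier_vec N" "v \<in> carrier_vec N"
  shows "(outer_self x *\<^sub>v v) \<bullet>c v = of_real ((cmod (x \<bullet>c v))\<^sup>2)"
proof -
  have "(outer_self x *\<^sub>v v) \<bullet>c v = (\<Sum>i<N. (\<Sum>j<N. x $ i * cnj (x $ j) * v $ j) * cnj (v $ i))"
    using assms by (auto simp: outer_self_def scalar_prod_def atLeast0LessThan intro!: sum.cong)
  also have "\<dots> = (\<Sum>i<N. x $ i * cnj (v $ i)) * cnj (\<Sum>j<N. x $ j * cnj (v $ j))"
    by (subst cnj_sum, subst sum_product) (simp add: sum_distrib_left sum_distrib_right mult_ac)
  also have "(\<Sum>i<N. x $ i * cnj (v $ i)) = x \<bullet>c v"
    using assms by (simp add: scalar_prod_def atLeast0LessThan)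
  finally show ?thesis
    by (simp only: complex_norm_square)
qed

lemma outer_self_psd:
  assumes x: "x \<in> carrier_vec N"
  shows "outer_self x \<in> hermitian_psd N"
proof -
  have "mat_adjoint (outer_self x) = outer_self x"
    using x by (intro eq_matI) (auto simp: mat_adjoint_def mat_of_rows_index outer_self_def)
  then show ?thesis
    using x outer_self_scalar_prod[OF x]
    by (auto simp: hermitian_psd_def) (auto simp: outer_self_def)
qed

lemma sdp_cost_outer_self:
  assumes x: "x \<in> carrier_vec N"
  shows "sdp_cost M N b (outer_self x) = ls_cost M N b x"
proof -
  have "outer_self x \<in> carrier_mat N N"
    using x by (simp add: outer_self_def)
  then show ?thesis
    by (simp add: sdp_cost_def ls_cost_def dft_vec_eq_circle_vec trace_outer_self_mult
        outer_self_scalar_prod[OF x])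
qed

section \<open>Existence of a least-squares minimizer\<close>

lemma dft_node_orthogonality:
  assumes "k < M" "n < M"
  shows "(\<Sum>m<M. dft_node M m ^ n / dft_node M m ^ k) = (if n = k then of_nat M else 0)"
proof -
  define \<omega> where "\<omega> = cis (- (2 * pi * (real n - real k) / real M))"
  have M: "M > 0" using assms by simp
  have term_eq: "dft_node M m ^ n / dft_node M m ^ k = \<omega> ^ m" for m
    by (simp add: dft_node_def \<omega>_def DeMoivre cis_divide diff_divide_distrib algebra_simps)
  have pow: "\<omega> ^ M = 1"
  proof -
    have "real M * (- (2 * pi * (real n - real k) / real M)) = 2 * pi * (real k - real n)"
      using M by (simp add: field_simps)
    then have "\<omega> ^ M = cis (2 * pi * (real k - real n))"
      by (simp only: \<omega>_def DeMoivre)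
    also have "\<dots> = 1"
      using cis_multiple_2pi[of "real k - real n"] by simp
    finally show ?thesis .
  qed
  show ?thesis
  proof (cases "n = k")
    case True
    then show ?thesis by (simp add: dft_node_def)
  next
    case False
    have "\<omega> \<noteq> 1"
    proof
      assume "\<omega> = 1"
      then have "cos (2 * pi * (real n - real k) / real M) = 1"
        by (metis \<omega>_def cis.sel(1) cos_minus one_complex.sel(1))
      then obtain z :: int where "2 * pi * (real n - real k) / real M = of_int z * 2 * pi"
        by (auto simp: cos_one_2pi_int)
      then have "2 * pi * (real n - real k) = 2 * pi * (of_int z * real M)"
        using M by (simp add: field_simps)
      then have "real n - real k = of_int z * real M"
        by (subst (asm) mult_cancel_left) simp
      then have "int n - int k = z * int M"
        by (metis of_int_diff of_int_eq_iff of_int_mult of_int_of_nat_eq)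
      then have "int M dvd int n - int k" by simp
      then have "\<bar>int n - int k\<bar> \<ge> int M"
        using False dvd_imp_le_int[of "int n - int k" "int M"] by simp
      then show False using assms by linarith
    qed
    then show ?thesis
      using False pow unfolding term_eq by (simp add: geometric_sum)
  qed
qed

lemma dft_inversion:
  assumes "N \<le> M" "k < N"
  shows "of_nat M * x k = (\<Sum>m<M. (\<Sum>n<N. x n * dft_node M m ^ n) / dft_node M m ^ k)"
proof -
  have "(\<Sum>m<M. (\<Sum>n<N. x n * dft_node M m ^ n) / dft_node M m ^ k) =
      (\<Sum>n<N. x n * (\<Sum>m<M. dft_node M m ^ n / dft_node M m ^ k))"
    unfolding sum_divide_distrib by (subst sum.swap) (simp add: sum_distrib_left)
  also have "\<dots> = (\<Sum>n<N. if n = k then x n * of_nat M else 0)"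
    using assms by (intro sum.cong) (auto simp: dft_node_orthogonality)
  also have "\<dots> = of_nat M * x k"
    using assms by simp
  finally show ?thesis ..
qed

text \<open>Only finiteness of the bound matters, so the linear terms are estimated crudely by \<open>u \<le> 1 + u\<^sup>2\<close>,
  once for \<open>\<bar>f\<^sub>m\<^sup>H x\<bar>\<close> and once for the residual.\<close>

lemma sublevel_entry_bound:
  fixes b :: "real vec" and x :: "nat \<Rightarrow> complex"
  assumes "N \<le> M" "k < N"
    and cost: "(\<Sum>m<M. (b $ m - (cmod (\<Sum>n<N. x n * dft_node M m ^ n))\<^sup>2)\<^sup>2) \<le> C"
  shows "cmod (x k) \<le> (\<Sum>m<M. \<bar>b $ m\<bar> + C + 2)"
proof -
  define y where "y m = (\<Sum>n<N. x n * dft_node M m ^ n)" for m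
  have y_le: "cmod (y m) \<le> \<bar>b $ m\<bar> + C + 2" if "m < M" for m
  proof -
    define t where "t = b $ m - (cmod (y m))\<^sup>2"
    have "t\<^sup>2 \<le> (\<Sum>m<M. (b $ m - (cmod (y m))\<^sup>2)\<^sup>2)"
      unfolding t_def by (rule member_le_sum) (use that in auto)
    then have "t\<^sup>2 \<le> C" using cost by (simp add: y_def)
    have le: "u \<le> 1 + u\<^sup>2" for u :: real
    proof -
      have "2 * u \<le> 1 + u\<^sup>2"
        using zero_le_power2[of "u - 1"] by (simp add: power2_diff)
      then show ?thesis using zero_le_power2[of u] by linarith
    qed
    have "cmod (y m) \<le> 1 + (cmod (y m))\<^sup>2" by (rule le)
    also have "\<dots> = 1 + b $ m + (- t)" by (simp add: t_def)
    also have "- t \<le> 1 + t\<^sup>2" using le[of "- t"] by simp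
    finally show ?thesis using \<open>t\<^sup>2 \<le> C\<close> by linarith
  qed
  have M: "real M \<ge> 1" using assms by simp
  have "cmod (x k) \<le> real M * cmod (x k)"
    using mult_right_mono[OF M norm_ge_zero[of "x k"]] by simp
  also have "\<dots> = cmod (\<Sum>m<M. y m / dft_node M m ^ k)"
    using arg_cong[OF dft_inversion[OF assms(1,2), of x], of cmod] by (simp add: y_def norm_mult)
  also have "\<dots> \<le> (\<Sum>m<M. cmod (y m / dft_node M m ^ k))"
    by (rule norm_sum)
  also have "\<dots> \<le> (\<Sum>m<M. \<bar>b $ m\<bar> + C + 2)"
    by (rule sum_mono) (use y_le in \<open>simp add: norm_divide norm_power\<close>)
  finally show ?thesis .
qed

text \<open>The type of vectors of arbitrary dimension carries no topology, so the compactness argument takes place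
  in \<open>nat \<Rightarrow> complex\<close> with the product topology, on the functions supported in \<open>{..<N}\<close> whose entries
  satisfy the bound that the cost of the zero vector imposes.\<close>

lemma ls_cost_min_exists:
  fixes b :: "real vec"
  assumes "N \<le> M"
  obtains x where "x \<in> carrier_vec N"
    and "\<And>y. y \<in> carrier_vec N \<Longrightarrow> ls_cost M N b x \<le> ls_cost M N b y"
proof -
  define c where
    "c f = (\<Sum>m<M. (b $ m - (cmod (\<Sum>n<N. f n * dft_node M m ^ n))\<^sup>2)\<^sup>2)" for f :: "nat \<Rightarrow> complex"
  define R where "R = (\<Sum>m<M. \<bar>b $ m\<bar> + c (\<lambda>_. 0) + 2)"
  define K :: "(nat \<Rightarrow> complex) set" where "K = PiE UNIV (\<lambda>k. if k < N then cball 0 R else {0})"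
  have "c (\<lambda>_. 0) \<ge> 0" by (simp add: c_def sum_nonneg)
  then have "R \<ge> 0" by (simp add: R_def sum_nonneg)
  then have zero: "(\<lambda>_. 0) \<in> K" by (auto simp: K_def)
  have "compactin (product_topology (\<lambda>_. euclidean) UNIV) K"
    unfolding K_def by (subst compactin_PiE) auto
  then have "compact K"
    by (simp add: euclidean_product_topology)
  moreover have "continuous_on K c"
    unfolding c_def[abs_def]
    by (intro continuous_intros continuous_on_subset[OF continuous_on_product_coordinates]) auto
  ultimately obtain f where f: "f \<in> K" "\<And>g. g \<in> K \<Longrightarrow> c f \<le> c g"
    using continuous_attains_inf[of K c] zero by blast
  have c_vec: "ls_cost M N b y = c (\<lambda>k. if k < N then y $ k else 0)" if "y \<in> carrier_vec N" for y
    by (simp add: ls_cost_eq[OF that] c_def)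
  have "ls_cost M N b (vec N f) \<le> ls_cost M N b y" if y: "y \<in> carrier_vec N" for y
  proof -
    define g where "g k = (if k < N then y $ k else 0)" for k
    have "c f \<le> c g"
    proof (cases "c g \<le> c (\<lambda>_. 0)")
      case True
      have "g \<in> K"
        using sublevel_entry_bound[OF assms _ True[unfolded c_def[of g]]]
        by (auto simp: K_def R_def g_def)
      then show ?thesis by (rule f(2))
    next
      case False
      then show ?thesis using f(2)[OF zero] by linarith
    qed
    moreover have "ls_cost M N b (vec N f) = c f"
      by (simp add: ls_cost_eq c_def)
    ultimately show ?thesis
      using c_vec[OF y] by (simp add: g_def[abs_def])
  qed
  then show ?thesis using that[of "vec N f"] by simp
qed

section \<open>Tightness of the relaxation\<close>

theorem mainTheorem1:
  fixes M N :: nat and b :: "real vec"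
  assumes "N \<ge> 1" and "M \<ge> N" and "b \<in> carrier_vec M"
  shows "(\<exists>x\<in>carrier_vec N. \<exists>X.
            is_arg_min (sdp_cost M N b) (\<lambda>Y. Y \<in> hermitian_psd N) X \<and>
            ls_cost M N b x = sdp_cost M N b X) \<and>
         (\<exists>x X.
            is_arg_min (\<lambda>y. (eucl_norm (b - sq_abs_vec (dft_mat M N *\<^sub>v y)))\<^sup>2)
              (\<lambda>y. y \<in> carrier_vec N) x \<and>
            is_arg_min (sdp_cost M N b) (\<lambda>Y. Y \<in> hermitian_psd N) X \<and>
            (eucl_norm (b - sq_abs_vec (dft_mat M N *\<^sub>v x)))\<^sup>2 = sdp_cost M N b X)"
proof -
  obtain x where x: "x \<in> carrier_vec N"
    and x_min: "\<And>y. y \<in> carrier_vec N \<Longrightarrow> ls_cost M N b x \<le> ls_cost M N b y"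
    using ls_cost_min_exists[OF assms(2)] by blast
  have "ls_cost M N b x \<le> sdp_cost M N b Y" if "Y \<in> hermitian_psd N" for Y
    using sdp_cost_attained_by_vector[OF that assms(1), of M b] x_min by metis
  then have X_min: "is_arg_min (sdp_cost M N b) (\<lambda>Y. Y \<in> hermitian_psd N) (outer_self x)"
    using outer_self_psd[OF x] by (simp add: is_arg_min_linorder sdp_cost_outer_self[OF x])
  have "is_arg_min (\<lambda>y. (eucl_norm (b - sq_abs_vec (dft_mat M N *\<^sub>v y)))\<^sup>2)
      (\<lambda>y. y \<in> carrier_vec N) x"
    using x x_min by (simp add: is_arg_min_linorder eucl_norm_residual_eq_ls_cost[OF _ assms(3)])
  then show ?thesis
    using x X_min sdp_cost_outer_self[OF x, of M b] eucl_norm_residual_eq_ls_cost[OF x assms(3)]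
    by metis
qed

end
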